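(* Let $n \geq 4$ and $k$ be integers with $1 \leq k \leq n/2$, and let $P(n,k)$ be the generalised Petersen graph, with spectrum (the eigenvalues of its adjacency matrix, listed with multiplicity) $$3=\lambda_1 > \lambda_2 \geq \cdots \geq \lambda_{2n}.$$ Then $$\lambda_1 - \lambda_2 < \frac{4 \pi}{[n^{1/2}]-1},$$ where $[x]$ denotes the integer part of $x$.
   Context: For positive integers $n \geq 3$ and $k \leq n/2$, the generalised Petersen graph $P(n,k)$ is the graph with vertex set $\{a_i, b_i : 0 \leq i \leq n-1\}$ (so $2n$ vertices) and edges $a_i a_{i+1}$, $a_i b_i$, $b_i b_{i+k}$ for $0 \leq i \leq n-1$, with subscripts read modulo $n$. When $k=n/2$, the edges $b_ib_{i+k}$ and $b_{i+k}b_{i+2k}=b_{i+k}b_i$ are counted separately, so that $b_i$ and $b_{i+k}$ are joined by a double edge (adjacency matrix entry $2$). With this convention $P(n,k)$ is always connected and cubic ($3$-regular). *)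

theory Defs
  imports
    Complex_Main
    "HOL-Library.Multiset"
    "HOL-Computational_Algebra.Polynomial"
    "Jordan_Normal_Form.Char_Poly"
begin

(* The vertices of P(n,k) are the numbers 0, ..., 2n - 1: the vertex a_i is i mod n
   and the vertex b_i is n + i mod n, so subscripts are read modulo n. *)

definition vertex_a :: "nat \<Rightarrow> nat \<Rightarrow> nat" where
  "vertex_a n i = i mod n"

definition vertex_b :: "nat \<Rightarrow> nat \<Rightarrow> nat" where
  "vertex_b n i = n + i mod n"

(* The edges form a multiset with one member for each index i in each family; for 2k = n
   the edges b_i b_{i+k} and b_{i+k} b_{i+2k} coincide as sets and give multiplicity 2. *)

definition petersen_edges :: "nat \<Rightarrow> nat \<Rightarrow> nat set multiset" where
  "petersen_edges n k =
     image_mset (\<lambda>i. {vertex_a n i, vertex_a n (i + 1)}) (mset_set {0..<n})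
   + image_mset (\<lambda>i. {vertex_a n i, vertex_b n i}) (mset_set {0..<n})
   + image_mset (\<lambda>i. {vertex_b n i, vertex_b n (i + k)}) (mset_set {0..<n})"

definition adjacency_matrix :: "nat \<Rightarrow> nat set multiset \<Rightarrow> real mat" where
  "adjacency_matrix N E = mat N N (\<lambda>(u, v). real (count E {u, v}))"

(* proots counts each real root with its order, i.e. its algebraic multiplicity; for a
   symmetric matrix these are all the eigenvalues. *)

definition eigenvalues_desc :: "real mat \<Rightarrow> real list" where
  "eigenvalues_desc A = rev (sorted_list_of_multiset (proots (char_poly A)))"

(* The list is indexed from 0: its entry i - 1 is the i-th largest eigenvalue. *)

definition petersen_spectrum :: "nat \<Rightarrow> nat \<Rightarrow> real list" where
  "petersen_spectrum n k = eigenvalues_desc (adjacency_matrix (2 * n) (petersen_edges n k))"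

end

theory Submission
  imports "HOL-Analysis.Kronecker_Approximation_Theorem" Defs
begin

text \<open>
  The adjacency matrix consists of four commuting blocks: two circulants and two identities.
  The real Hartley matrix, with entries \<open>cas (2\<pi>ij/n)\<close> where \<open>cas = cos + sin\<close>, squares to \<open>n\<close> times
  the identity and diagonalises every symmetric circulant, so the characteristic polynomial is the
  product over \<open>j < n\<close> of \<open>(x - a\<^sub>j)(x - b\<^sub>j) - 1\<close> with \<open>a\<^sub>j = 2 cos (2\<pi>j/n)\<close> and
  \<open>b\<^sub>j = 2 cos (2\<pi>jk/n)\<close>. The factor \<open>j = 0\<close> has roots 3 and 1; all other roots are below 3.
  The larger root of the \<open>j\<close>-th factor is at least \<open>(a\<^sub>j + b\<^sub>j)/2 + 1\<close>. With \<open>m = [\<surd>n]\<close>, Dirichlet's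
  theorem gives \<open>0 < j \<le> m\<close> such that \<open>jk/n\<close> is within \<open>1/m\<close> of an integer; also
  \<open>j/n \<le> 1/m\<close>, so by \<open>cos x \<ge> 1 - x\<^sup>2/2\<close> the gap is at most \<open>(2\<pi>/m)\<^sup>2 < 4\<pi>/(m - 1)\<close>.
\<close>

section \<open>The function \<open>cas\<close> and trigonometric sums in arithmetic
  progression\<close>

definition cas :: "real \<Rightarrow> real" where
  "cas x = cos x + sin x"

lemma cas_mult: "cas x * cas y = cos (x - y) + sin (x + y)"
  by (simp add: cas_def cos_diff sin_add algebra_simps)

lemma cas_add_cas: "cas (x + y) + cas (x - y) = 2 * cos y * cas x"
  by (simp add: cas_def cos_diff sin_add cos_add sin_diff algebra_simps)

lemma cas_add_2pi_nat: "cas (x + 2 * pi * real m) = cas x"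
  using sin_int_2pin[of "int m"] cos_int_2pin[of "int m"]
  by (simp add: cas_def cos_add sin_add)

lemma cas_mod:
  assumes "n > 0"
  shows "cas (2 * pi * real (a mod n * c) / real n) = cas (2 * pi * real (a * c) / real n)"
proof -
  have "real (a * c) = real (a mod n * c) + real n * real (a div n * c)"
    by (metis (no_types, opaque_lifting) add_mult_distrib mod_mult_div_eq mult.assoc of_nat_add of_nat_mult)
  then have "2 * pi * real (a * c) / real n
      = 2 * pi * real (a mod n * c) / real n + 2 * pi * real (a div n * c)"
    using assms by (simp add: field_simps)
  then show ?thesis by (simp only: cas_add_2pi_nat)
qed

text \<open>Multiplication by \<open>2 * sin h\<close> makes the sum telescope. Since
  \<open>2 * n * h\<close> is a full number of turns, the end term is \<open>sin (- h)\<close> and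
  cancels the initial \<open>sin h\<close>.\<close>

lemma sum_cos_arith:
  fixes h :: real
  assumes "sin h \<noteq> 0" "sin (2 * real n * h) = 0" "cos (2 * real n * h) = 1"
  shows "(\<Sum>l<n. cos (2 * real l * h)) = 0"
proof -
  have "2 * sin h * (\<Sum>l<m. cos (2 * real l * h)) = sin ((2 * real m - 1) * h) + sin h" for m
  proof (induction m)
    case (Suc m)
    have *: "(2 * real (Suc m) - 1) * h = 2 * real m * h + h" "(2 * real m - 1) * h = 2 * real m * h - h"
      by (simp_all add: algebra_simps)
    show ?case using Suc unfolding * by (simp add: sin_add sin_diff algebra_simps)
  qed simp
  from this[of n] have "2 * sin h * (\<Sum>l<n. cos (2 * real l * h)) = sin (2 * real n * h - h) + sin h"
    by (simp add: algebra_simps)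
  then show ?thesis using assms by (simp add: sin_diff)
qed

text \<open>Unlike the cosine sum, this one vanishes even for \<open>sin h = 0\<close>: then
  \<open>h\<close> is a multiple of pi and so every term is zero. Otherwise the telescoping argument
  applies again.\<close>

lemma sum_sin_arith:
  fixes h :: real
  assumes "sin (2 * real n * h) = 0" "cos (2 * real n * h) = 1"
  shows "(\<Sum>l<n. sin (2 * real l * h)) = 0"
proof (cases "sin h = 0")
  case True
  have "sin (2 * real l * h) = 0" for l :: nat
    using True by (auto simp: sin_zero_iff_int2) (metis mult.assoc of_int_mult of_int_of_nat_eq of_int_numeral)
  then show ?thesis by simp
next
  case False
  have "2 * sin h * (\<Sum>l<m. sin (2 * real l * h)) = cos h - cos ((2 * real m - 1) * h)" for m
  proof (induction m)
    case (Suc m)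
    have *: "(2 * real (Suc m) - 1) * h = 2 * real m * h + h" "(2 * real m - 1) * h = 2 * real m * h - h"
      by (simp_all add: algebra_simps)
    show ?case using Suc unfolding * by (simp add: cos_add cos_diff algebra_simps)
  qed simp
  from this[of n] have "2 * sin h * (\<Sum>l<n. sin (2 * real l * h)) = cos h - cos (2 * real n * h - h)"
    by (simp add: algebra_simps)
  then show ?thesis using False assms by (simp add: cos_diff)
qed

section \<open>The Hartley matrix and its square\<close>

definition hartley_mat :: "nat \<Rightarrow> real mat" where
  "hartley_mat n = mat n n (\<lambda>(i, j). cas (2 * pi * real (i * j) / real n))"

lemma hartley_mat_carrier [simp]: "hartley_mat n \<in> carrier_mat n n"
  by (simp add: hartley_mat_def)

lemma hartley_mat_dim [simp]: "dim_row (hartley_mat n) = n" "dim_col (hartley_mat n) = n"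
  by (simp_all add: hartley_mat_def)

lemma hartley_mat_square: "hartley_mat n * hartley_mat n = real n \<cdot>\<^sub>m 1\<^sub>m n"
proof (rule eq_matI)
  fix i j assume ij: "i < dim_row (real n \<cdot>\<^sub>m 1\<^sub>m n :: real mat)" "j < dim_col (real n \<cdot>\<^sub>m 1\<^sub>m n :: real mat)"
  then have ij': "i < n" "j < n" by auto
  \<comment> \<open>Half-angles: by \<open>cas_mult\<close> the l-th term of the scalar product is a
    cosine of \<open>2 * l * h1\<close> plus a sine of \<open>2 * l * h2\<close>, the form summed
    above. The cosines give orthogonality, the sines always cancel.\<close>
  define h1 where "h1 = pi * (real i - real j) / real n"
  define h2 where "h2 = pi * (real i + real j) / real n"
  have per: "sin (2 * real n * (pi * of_int m / real n)) = 0"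
    "cos (2 * real n * (pi * of_int m / real n)) = 1" for m :: int
    using ij' sin_int_2pin[of m] cos_int_2pin[of m] by (simp_all add: field_simps)
  have h2: "(\<Sum>l<n. sin (2 * real l * h2)) = 0"
  proof -
    have "h2 = pi * of_int (int i + int j) / real n" by (simp add: h2_def)
    then show ?thesis using per[of "int i + int j"] sum_sin_arith[of n h2] by metis
  qed
  have h1: "(\<Sum>l<n. cos (2 * real l * h1)) = (if i = j then real n else 0)"
  proof (cases "i = j")
    case True
    then show ?thesis by (simp add: h1_def)
  next
    case False
    have "sin h1 \<noteq> 0"
    proof
      assume "sin h1 = 0"
      then obtain z :: int where "h1 = of_int z * pi" by (auto simp: sin_zero_iff_int2)
      then have "pi * (real i - real j) = pi * (of_int z * real n)"
        using ij' by (simp add: h1_def field_simps)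
      then have "real i - real j = of_int z * real n" by simp
      then have "int i - int j = z * int n"
        by (metis of_int_diff of_int_eq_iff of_int_mult of_int_of_nat_eq)
      moreover have "\<bar>int i - int j\<bar> < int n" using ij' by auto
      ultimately show False using False
        by (metis dvd_triv_right eq_iff_diff_eq_0 of_nat_eq_iff zdvd_not_zless zero_less_abs_iff
            dvd_abs_iff)
    qed
    moreover have "h1 = pi * of_int (int i - int j) / real n" by (simp add: h1_def)
    ultimately show ?thesis
      using per[of "int i - int j"] False sum_cos_arith[of h1 n] by metis
  qed
  have "(hartley_mat n * hartley_mat n) $$ (i, j)
      = (\<Sum>l<n. cas (2 * pi * real (i * l) / real n) * cas (2 * pi * real (l * j) / real n))"
    using ij' by (simp add: hartley_mat_def scalar_prod_def atLeast0LessThan)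
  also have "\<dots> = (\<Sum>l<n. cos (2 * real l * h1) + sin (2 * real l * h2))"
    unfolding cas_mult h1_def h2_def
    by (intro sum.cong arg_cong2[where f="(+)"] arg_cong[where f=cos] arg_cong[where f=sin])
      (auto simp: diff_divide_distrib add_divide_distrib algebra_simps)
  finally show "(hartley_mat n * hartley_mat n) $$ (i, j) = (real n \<cdot>\<^sub>m 1\<^sub>m n) $$ (i, j)"
    using ij' h1 h2 by (simp add: sum.distrib)
qed auto

text \<open>The two indicators are added, not disjoined, so that the entry is 2 when
  \<open>2 * s = n\<close>, as for a double edge.\<close>

definition circ_mat :: "nat \<Rightarrow> nat \<Rightarrow> real mat" where
  "circ_mat n s = mat n n (\<lambda>(u, v). of_bool ((u + s) mod n = v) + of_bool ((v + s) mod n = u))"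

definition circ_eig :: "nat \<Rightarrow> nat \<Rightarrow> nat \<Rightarrow> real" where
  "circ_eig n s j = 2 * cos (2 * pi * real (s * j) / real n)"

lemma circ_mat_carrier [simp]: "circ_mat n s \<in> carrier_mat n n"
  by (simp add: circ_mat_def)

text \<open>Row \<open>u\<close> of the circulant adds the values of \<open>cas\<close> at the
  shifts of \<open>u\<close> by \<open>s\<close> in both directions; \<open>cas_add_cas\<close>
  turns their sum into a multiple of the value at \<open>u\<close>.\<close>

lemma circ_mat_hartley:
  assumes "s \<le> n"
  shows "circ_mat n s * hartley_mat n = hartley_mat n * mat_diag n (circ_eig n s)"
proof (rule eq_matI)
  fix u c assume "u < dim_row (hartley_mat n * mat_diag n (circ_eig n s))"
    "c < dim_col (hartley_mat n * mat_diag n (circ_eig n s))"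
  then have uc: "u < n" "c < n" by (auto simp: mat_diag_def)
  define f where "f v = cas (2 * pi * real (v * c) / real n)" for v
  \<comment> \<open>The backward shift by \<open>s\<close> is written as the forward shift by
    \<open>n - s\<close>; here \<open>s \<le> n\<close> enters. The angle then changes by
    \<open>c\<close> full turns.\<close>
  have inv: "(v + s) mod n = u \<longleftrightarrow> (u + (n - s)) mod n = v" if "v < n" for v
    using that uc assms by (auto simp: mod_if)
  have "(circ_mat n s * hartley_mat n) $$ (u, c)
      = (\<Sum>v<n. (of_bool ((u + s) mod n = v) + of_bool ((v + s) mod n = u)) * f v)"
    using uc by (simp add: hartley_mat_def circ_mat_def scalar_prod_def atLeast0LessThan f_def)
  also have "\<dots> = (\<Sum>v<n. (if (u + s) mod n = v then f v else 0) + (if (u + (n - s)) mod n = v then f v else 0))"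
    by (intro sum.cong) (auto simp: inv)
  also have "\<dots> = f ((u + s) mod n) + f ((u + (n - s)) mod n)"
    using uc by (simp add: sum.distrib)
  also have "\<dots> = f (u + s) + f (u + (n - s))"
    using uc unfolding f_def by (simp only: cas_mod)
  also have "\<dots> = 2 * cos (2 * pi * real (s * c) / real n) * f u"
  proof -
    have 1: "2 * pi * real ((u + s) * c) / real n
        = 2 * pi * real (u * c) / real n + 2 * pi * real (s * c) / real n"
      by (simp add: add_divide_distrib algebra_simps)
    have 2: "2 * pi * real ((u + (n - s)) * c) / real n
        = (2 * pi * real (u * c) / real n - 2 * pi * real (s * c) / real n) + 2 * pi * real c"
      using uc assms by (simp add: of_nat_diff field_simps)
    show ?thesis unfolding f_def 1 2 cas_add_2pi_nat by (rule cas_add_cas)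
  qed
  finally show "(circ_mat n s * hartley_mat n) $$ (u, c)
      = (hartley_mat n * mat_diag n (circ_eig n s)) $$ (u, c)"
    unfolding mat_diag_mult_right[OF hartley_mat_carrier]
    using uc by (simp add: hartley_mat_def f_def circ_eig_def)
qed (auto simp: circ_mat_def mat_diag_def)

section \<open>The adjacency matrix in block form\<close>

lemma count_image_mset_set:
  assumes "finite A"
  shows "real (count (image_mset f (mset_set A)) x) = (\<Sum>i\<in>A. of_bool (f i = x))"
  using assms by (induction A rule: finite_induct) auto

text \<open>A shift by \<open>0 < s < n\<close> fixes no index, so there are no loops and only
  \<open>i = u\<close> and \<open>i = v\<close> can produce the pair. Both do so when
  \<open>2 * s = n\<close> and \<open>v\<close> is opposite \<open>u\<close>.\<close>

lemma count_cycle_edges: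
  fixes n s u v :: nat
  assumes "u < n" "v < n" "0 < s" "s < n"
  shows "(\<Sum>i<n. of_bool ({i, (i + s) mod n} = {u, v}))
    = (of_bool ((u + s) mod n = v) + of_bool ((v + s) mod n = u) :: real)"
proof -
  have ne: "(i + s) mod n \<noteq> i" if "i < n" for i
  proof -
    have "(i + s) mod n = (if i + s < n then i + s else i + s - n)"
      using that assms by (simp add: le_mod_geq)
    then show ?thesis using that assms by (auto simp del: mod_eq_self_iff_div_eq_0)
  qed
  have "(\<Sum>i<n. of_bool ({i, (i + s) mod n} = {u, v}))
      = (\<Sum>i<n. (if i = u then of_bool ((u + s) mod n = v) else 0)
        + (if i = v then of_bool ((v + s) mod n = u) else 0) :: real)"
    using ne assms by (intro sum.cong) (auto simp: doubleton_eq_iff)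
  then show ?thesis using assms by (simp add: sum.distrib)
qed

lemma adjacency_matrix_petersen:
  assumes "2 \<le> n" "0 < k" "k < n"
  shows "adjacency_matrix (2 * n) (petersen_edges n k)
    = four_block_mat (circ_mat n 1) (1\<^sub>m n) (1\<^sub>m n) (circ_mat n k)"
proof (rule eq_matI)
  fix u v
  assume "u < dim_row (four_block_mat (circ_mat n 1) (1\<^sub>m n) (1\<^sub>m n) (circ_mat n k))"
    "v < dim_col (four_block_mat (circ_mat n 1) (1\<^sub>m n) (1\<^sub>m n) (circ_mat n k))"
  then have uv: "u < 2 * n" "v < 2 * n" by (auto simp: circ_mat_def)
  have modlt: "\<not> n \<le> x mod n" for x using assms by (simp add: not_le)
  have "adjacency_matrix (2 * n) (petersen_edges n k) $$ (u, v)
    = (\<Sum>i<n. of_bool ({i, (i + 1) mod n} = {u, v})) + (\<Sum>i<n. of_bool ({i, n + i} = {u, v}))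
      + (\<Sum>i<n. of_bool ({n + i, n + (i + k) mod n} = {u, v}))"
    using uv
    by (simp add: adjacency_matrix_def petersen_edges_def count_image_mset_set vertex_a_def
      vertex_b_def atLeast0LessThan)
  also have "\<dots> = four_block_mat (circ_mat n 1) (1\<^sub>m n) (1\<^sub>m n) (circ_mat n k) $$ (u, v)"
  proof -
    \<comment> \<open>Each block meets just one edge family: outer cycle, spokes (twice), inner
      edges.\<close>
    consider (aa) "u < n" "v < n" | (ab) "u < n" "n \<le> v" | (ba) "n \<le> u" "v < n" | (bb) "n \<le> u" "n \<le> v"
      by linarith
    then show ?thesis
    proof cases
      case aa
      have "(\<Sum>i<n. of_bool ({i, n + i} = {u, v})) = (0::real)"
        using aa by (intro sum.neutral) (auto simp: doubleton_eq_iff)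
      moreover have "(\<Sum>i<n. of_bool ({n + i, n + (i + k) mod n} = {u, v})) = (0::real)"
        using aa by (intro sum.neutral) (auto simp: doubleton_eq_iff)
      ultimately show ?thesis
        using aa assms count_cycle_edges[of u n v 1] by (simp add: circ_mat_def)
    next
      case ab
      have "(\<Sum>i<n. of_bool ({i, (i + 1) mod n} = {u, v})) = (0::real)"
        using ab by (intro sum.neutral) (auto simp: doubleton_eq_iff modlt)
      moreover have "(\<Sum>i<n. of_bool ({n + i, n + (i + k) mod n} = {u, v})) = (0::real)"
        using ab by (intro sum.neutral) (auto simp: doubleton_eq_iff)
      moreover have "(\<Sum>i<n. of_bool ({i, n + i} = {u, v})) = (\<Sum>i<n. if i = u then of_bool (u = v - n) else 0 :: real)"
        using ab by (intro sum.cong) (auto simp: doubleton_eq_iff)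
      ultimately show ?thesis
        using ab uv by (simp add: circ_mat_def)
    next
      case ba
      have "(\<Sum>i<n. of_bool ({i, (i + 1) mod n} = {u, v})) = (0::real)"
        using ba by (intro sum.neutral) (auto simp: doubleton_eq_iff modlt)
      moreover have "(\<Sum>i<n. of_bool ({n + i, n + (i + k) mod n} = {u, v})) = (0::real)"
        using ba by (intro sum.neutral) (auto simp: doubleton_eq_iff)
      moreover have "(\<Sum>i<n. of_bool ({i, n + i} = {u, v})) = (\<Sum>i<n. if i = v then of_bool (u - n = v) else 0 :: real)"
        using ba by (intro sum.cong) (auto simp: doubleton_eq_iff)
      ultimately show ?thesis
        using ba uv by (simp add: circ_mat_def)
    next
      case bb
      have "(\<Sum>i<n. of_bool ({i, (i + 1) mod n} = {u, v})) = (0::real)"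
        using bb by (intro sum.neutral) (auto simp: doubleton_eq_iff modlt)
      moreover have "(\<Sum>i<n. of_bool ({i, n + i} = {u, v})) = (0::real)"
        using bb by (intro sum.neutral) (auto simp: doubleton_eq_iff)
      moreover have "(\<Sum>i<n. of_bool ({n + i, n + (i + k) mod n} = {u, v}))
          = (\<Sum>i<n. of_bool ({i, (i + k) mod n} = {u - n, v - n}) :: real)"
      proof (intro sum.cong refl arg_cong[where f=of_bool])
        fix i
        have "n + x = w \<longleftrightarrow> x = w - n" if "n \<le> w" for x w :: nat using that by auto
        then show "({n + i, n + (i + k) mod n} = {u, v}) = ({i, (i + k) mod n} = {u - n, v - n})"
          using bb by (simp only: doubleton_eq_iff)
      qed
      ultimately show ?thesis
        using bb uv assms count_cycle_edges[of "u - n" n "v - n" k] by (simp add: circ_mat_def)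
    qed
  qed
  finally show "adjacency_matrix (2 * n) (petersen_edges n k) $$ (u, v)
    = four_block_mat (circ_mat n 1) (1\<^sub>m n) (1\<^sub>m n) (circ_mat n k) $$ (u, v)" .
qed (auto simp: adjacency_matrix_def circ_mat_def)

section \<open>The characteristic polynomial\<close>

lemma char_poly_block_diag:
  fixes f g :: "nat \<Rightarrow> 'a :: idom"
  shows "char_poly (four_block_mat (mat_diag n f) (1\<^sub>m n) (1\<^sub>m n) (mat_diag n g))
    = (\<Prod>j<n. [:- f j, 1:] * [:- g j, 1:] - 1)"
proof -
  let ?D = "\<lambda>f. mat_diag n (\<lambda>j. [:- f j, 1:])"
  have *: "char_poly_matrix (four_block_mat (mat_diag n f) (1\<^sub>m n) (1\<^sub>m n) (mat_diag n g))
      = four_block_mat (?D f) (- 1\<^sub>m n) (- 1\<^sub>m n) (?D g)"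
    by (rule eq_matI) (auto simp: char_poly_matrix_def mat_diag_def one_pCons)
  have D: "?D f \<in> carrier_mat n n" for f by (simp add: mat_diag_def)
  \<comment> \<open>The blocks are diagonal or minus the identity, so they commute and the block
    determinant formula applies.\<close>
  have "char_poly (four_block_mat (mat_diag n f) (1\<^sub>m n) (1\<^sub>m n) (mat_diag n g))
      = det (?D f * ?D g - (- 1\<^sub>m n) * (- 1\<^sub>m n))"
    unfolding char_poly_def * using D[of f] D[of g]
    by (intro det_four_block_mat[of _ n]) (auto simp: carrier_matD[OF D])
  also have "?D f * ?D g - (- 1\<^sub>m n) * (- 1\<^sub>m n) = mat_diag n (\<lambda>j. [:- f j, 1:] * [:- g j, 1:] - 1)"
    unfolding mat_diag_diag by (rule eq_matI) (auto simp: mat_diag_def)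
  also have "det \<dots> = (\<Prod>j<n. [:- f j, 1:] * [:- g j, 1:] - 1)"
    by (subst det_upper_triangular[of _ n])
      (auto simp: mat_diag_def diag_mat_def prod.list_conv_set_nth atLeast0LessThan)
  finally show ?thesis .
qed

text \<open>Conjugation by the block diagonal matrix with two Hartley blocks diagonalises both
  circulants and leaves the identity blocks alone.\<close>

lemma char_poly_petersen:
  assumes "2 \<le> n" "0 < k" "k < n"
  shows "char_poly (adjacency_matrix (2 * n) (petersen_edges n k))
    = (\<Prod>j<n. [:- circ_eig n 1 j, 1:] * [:- circ_eig n k j, 1:] - 1)"
proof -
  let ?H = "hartley_mat n" and ?I = "1\<^sub>m n :: real mat" and ?Z = "0\<^sub>m n n :: real mat"
  let ?D = "\<lambda>s. mat_diag n (circ_eig n s)"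
  define A where "A = four_block_mat (circ_mat n 1) ?I ?I (circ_mat n k)"
  define B where "B = four_block_mat (?D 1) ?I ?I (?D k)"
  define P where "P = four_block_mat ?H ?Z ?Z ?H"
  define Q where "Q = (1 / real n) \<cdot>\<^sub>m P"
  have D: "?D s \<in> carrier_mat n n" for s by (simp add: mat_diag_def)
  have carr: "A \<in> carrier_mat (2*n) (2*n)" "B \<in> carrier_mat (2*n) (2*n)" "P \<in> carrier_mat (2*n) (2*n)"
    "Q \<in> carrier_mat (2*n) (2*n)"
    using D by (auto simp: A_def B_def P_def Q_def mult_2)
  have "P * P = four_block_mat (?H * ?H) ?Z ?Z (?H * ?H)"
    unfolding P_def by (subst mult_four_block_mat[of _ n n _ n _ n _ _ n _ n]) auto
  also have "\<dots> = real n \<cdot>\<^sub>m 1\<^sub>m (2 * n)"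
    unfolding hartley_mat_square by (rule eq_matI) auto
  finally have PP: "P * P = real n \<cdot>\<^sub>m 1\<^sub>m (2 * n)" .
  have PQ: "P * Q = 1\<^sub>m (2 * n)"
    unfolding Q_def using assms carr by (subst mult_smult_distrib) (auto simp: PP)
  have QP: "Q * P = 1\<^sub>m (2 * n)"
    unfolding Q_def using assms carr by (subst mult_smult_assoc_mat) (auto simp: PP)
  have "A * P = four_block_mat (circ_mat n 1 * ?H) ?H ?H (circ_mat n k * ?H)"
    unfolding A_def P_def
    by (subst mult_four_block_mat[of _ n n _ n _ n _ _ n _ n])
      (auto simp: right_mult_zero_mat[OF circ_mat_carrier]
        right_add_zero_mat[OF mult_carrier_mat[OF circ_mat_carrier hartley_mat_carrier]]
        left_add_zero_mat[OF mult_carrier_mat[OF circ_mat_carrier hartley_mat_carrier]])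
  also have "\<dots> = four_block_mat (?H * ?D 1) ?H ?H (?H * ?D k)"
    using assms by (simp add: circ_mat_hartley)
  also have "\<dots> = P * B"
    unfolding B_def P_def using D
    by (subst mult_four_block_mat[of _ n n _ n _ n _ _ n _ n])
      (auto simp: left_mult_zero_mat[OF D]
        right_add_zero_mat[OF mult_carrier_mat[OF hartley_mat_carrier D]]
        left_add_zero_mat[OF mult_carrier_mat[OF hartley_mat_carrier D]])
  finally have AP: "A * P = P * B" .
  have "A = A * (P * Q)" using carr by (simp add: PQ)
  also have "\<dots> = P * B * Q" using carr AP by (metis assoc_mult_mat)
  finally have "similar_mat A B"
    using carr PQ QP by (intro similar_matI[of _ _ P Q "2 * n"]) auto
  then have "char_poly A = char_poly B" by (rule char_poly_similar)
  then show ?thesis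
    unfolding adjacency_matrix_petersen[OF assms] A_def B_def char_poly_block_diag .
qed

section \<open>Roots of the quadratic factors\<close>

definition top_root :: "real \<Rightarrow> real \<Rightarrow> real" where
  "top_root a b = (a + b) / 2 + sqrt (((a - b) / 2)\<^sup>2 + 1)"

definition low_root :: "real \<Rightarrow> real \<Rightarrow> real" where
  "low_root a b = (a + b) / 2 - sqrt (((a - b) / 2)\<^sup>2 + 1)"

text \<open>Vieta: the roots have sum \<open>a + b\<close> and product \<open>a * b - 1\<close>.
  They are the eigenvalues of the symmetric 2 x 2 matrix with diagonal entries \<open>a\<close>,
  \<open>b\<close> and off-diagonal entries 1.\<close>

lemma quadratic_factorisation:
  "[:- a, 1:] * [:- b, 1:] - 1 = [:- top_root a b, 1:] * [:- low_root a b, 1:]"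
proof -
  have "(sqrt (((a - b) / 2)\<^sup>2 + 1))\<^sup>2 = ((a - b) / 2)\<^sup>2 + 1" by simp
  then have "top_root a b * low_root a b = a * b - 1"
    by (simp add: top_root_def low_root_def power2_eq_square field_simps)
  moreover have "top_root a b + low_root a b = a + b"
    by (simp add: top_root_def low_root_def)
  ultimately show ?thesis by (simp add: one_pCons algebra_simps)
qed

lemma top_root_bounds:
  "low_root a b < top_root a b" "(a + b) / 2 + 1 \<le> top_root a b"
proof -
  have "sqrt (((a - b) / 2)\<^sup>2 + 1) \<ge> 1" by simp
  then show "low_root a b < top_root a b" "(a + b) / 2 + 1 \<le> top_root a b"
    unfolding top_root_def low_root_def by linarith+
qed

text \<open>The quadratic is positive at 3, and 3 lies to the right of its axis
  \<open>(a + b) / 2\<close>, hence beyond both roots.\<close>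

lemma top_root_less_3:
  assumes "a < 2" "b \<le> 2"
  shows "top_root a b < 3"
proof -
  have "1 < (3 - a) * (3 - b)"
    using assms mult_strict_left_mono[of 1 "3 - a" 1] mult_left_mono[of 1 "3 - b" "3 - a"] by linarith
  \<comment> \<open>The difference of the squares \<open>(3 - (a + b) / 2)\<^sup>2\<close> and
    \<open>((a - b) / 2)\<^sup>2\<close> is \<open>(3 - a) * (3 - b)\<close>.\<close>
  then have "((a - b) / 2)\<^sup>2 + 1 < (3 - (a + b) / 2)\<^sup>2"
    by (simp add: power2_eq_square field_simps)
  moreover have "0 \<le> 3 - (a + b) / 2" using assms by simp
  ultimately have "sqrt (((a - b) / 2)\<^sup>2 + 1) < 3 - (a + b) / 2"
    by (metis real_sqrt_abs abs_of_nonneg real_sqrt_less_iff)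
  then show ?thesis by (simp add: top_root_def)
qed

lemma proots_petersen:
  assumes "2 \<le> n" "0 < k" "k < n"
  shows "proots (char_poly (adjacency_matrix (2 * n) (petersen_edges n k)))
    = (\<Sum>j<n. {#top_root (circ_eig n 1 j) (circ_eig n k j), low_root (circ_eig n 1 j) (circ_eig n k j)#})"
  unfolding char_poly_petersen[OF assms] quadratic_factorisation
  by (subst proots_prod) (auto simp: proots_mult add_mset_commute simp del: mult_pCons_left mult_pCons_right)

lemma circ_eig_le: "circ_eig n s j \<le> 2"
  by (simp add: circ_eig_def)

text \<open>Strictness holds for shift 1 because \<open>j / n\<close> is not an integer. For shift
  \<open>k\<close> the value 2 can recur, so \<open>top_root_less_3\<close> is strict in one
  argument only.\<close>

lemma circ_eig_1_less:
  assumes "0 < j" "j < n"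
  shows "circ_eig n 1 j < 2"
proof -
  define x where "x = pi * real j / real n"
  have "0 < x" "x < pi" using assms by (auto simp: x_def field_simps)
  then have "sin x > 0" by (rule sin_gt_zero)
  moreover have "cos (2 * x) = 1 - 2 * (sin x)\<^sup>2" by (rule cos_double_sin)
  ultimately have "cos (2 * x) < 1" by simp
  then show ?thesis by (simp add: circ_eig_def x_def mult.assoc)
qed

section \<open>Largest entries of sorted lists\<close>

lemma sorted_list_of_multiset_add_max:
  assumes "\<And>y. y \<in># M \<Longrightarrow> y \<le> x"
  shows "sorted_list_of_multiset (add_mset x M) = sorted_list_of_multiset M @ [x]"
proof -
  have "sorted (sorted_list_of_multiset M @ [x])"
    using assms by (simp add: sorted_append)
  then have "sorted_list_of_multiset (mset (sorted_list_of_multiset M @ [x]))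
      = sorted_list_of_multiset M @ [x]"
    by (metis sorted_list_of_multiset_mset sorted_sort_id)
  then show ?thesis by simp
qed

text \<open>The element \<open>y\<close> also ensures that the list is nonempty, so that index 0 is
  meaningful.\<close>

lemma le_hd_rev_sorted:
  assumes "sorted xs" "y \<in> set xs"
  shows "y \<le> rev xs ! 0" "rev xs ! 0 \<in> set xs"
  using assms by (cases xs rule: rev_cases; auto simp: sorted_append)+

section \<open>A frequency at which both cosines are close to 1\<close>

lemma ex_good_frequency:
  fixes m n k :: nat
  assumes "2 \<le> m" "m * m \<le> n"
  obtains j where "0 < j" "j < n" "1 - (2 * pi / m)\<^sup>2 / 2 \<le> circ_eig n 1 j / 2"
    "1 - (2 * pi / m)\<^sup>2 / 2 \<le> circ_eig n k j / 2"
proof -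
  obtain h j :: int where j: "0 < j" "j \<le> int m"
    and approx: "\<bar>of_int j * (real k / real n) - of_int h\<bar> < 1 / real m"
    using Dirichlet_approx[of m "real k / real n"] assms by (metis less_le_trans zero_less_numeral)
  define i where "i = nat j"
  have i: "0 < i" "i \<le> m" "of_int j = real i" using j by (auto simp: i_def)
  have n0: "0 < n" using assms by (metis gr0I le_zero_eq mult_is_0 not_numeral_le_zero)
  have cos_ge: "1 - (2 * pi / m)\<^sup>2 / 2 \<le> cos x" if "\<bar>x\<bar> \<le> 2 * pi / m" for x :: real
  proof -
    have "x\<^sup>2 \<le> (2 * pi / m)\<^sup>2" using that by (metis abs_ge_zero power2_abs power_mono)
    \<comment> \<open>By the half-angle formula, \<open>1 - cos x\<close> is twice the square of
      \<open>sin (x / 2)\<close>.\<close>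
    moreover have "1 - x\<^sup>2 / 2 \<le> cos x"
    proof -
      have "\<bar>sin (x / 2)\<bar> \<le> \<bar>x / 2\<bar>" by (rule abs_sin_x_le_abs_x)
      then have "(sin (x / 2))\<^sup>2 \<le> (x / 2)\<^sup>2" by (metis abs_ge_zero power2_abs power_mono)
      moreover have "cos (2 * (x / 2)) = 1 - 2 * (sin (x / 2))\<^sup>2" by (rule cos_double_sin)
      ultimately show ?thesis by (simp add: power_divide)
    qed
    ultimately show ?thesis by linarith
  qed
  show thesis
  proof
    show "0 < i" by fact
    \<comment> \<open>Dirichlet only gives \<open>i \<le> m\<close>; \<open>2 \<le> m\<close> makes
      this smaller than \<open>n\<close>, so the frequency is not the trivial one.\<close>
    have "m < m * m" using assms by simp
    then show "i < n" using i assms by linarith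
    have "real i * real m \<le> real n"
      using i assms by (metis le_trans mult_le_mono1 of_nat_le_iff of_nat_mult)
    then have "real i / real n \<le> 1 / real m" using n0 assms by (simp add: field_simps)
    then have "2 * pi * (real i / real n) \<le> 2 * pi * (1 / real m)" by (intro mult_left_mono) auto
    then show "1 - (2 * pi / m)\<^sup>2 / 2 \<le> circ_eig n 1 i / 2"
      unfolding circ_eig_def using cos_ge[of "2 * pi * real (1 * i) / real n"] by simp
    \<comment> \<open>The angle for shift \<open>k\<close> with \<open>h\<close> full turns
      removed.\<close>
    define y where "y = 2 * pi * (real i * (real k / real n) - of_int h)"
    have "\<bar>y\<bar> = 2 * pi * \<bar>real i * (real k / real n) - of_int h\<bar>"
      by (simp add: y_def abs_mult)
    also have "\<dots> \<le> 2 * pi * (1 / real m)"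
      using approx i by (intro mult_left_mono) auto
    finally have "\<bar>y\<bar> \<le> 2 * pi / m" by simp
    moreover have "cos (2 * pi * real (k * i) / real n) = cos y"
    proof -
      have "2 * pi * real (k * i) / real n = y + 2 * pi * of_int h"
        by (simp add: y_def algebra_simps)
      then show ?thesis by (simp add: cos_add)
    qed
    ultimately show "1 - (2 * pi / m)\<^sup>2 / 2 \<le> circ_eig n k i / 2"
      using cos_ge[of y] by (simp add: circ_eig_def)
  qed
qed

text \<open>Clearing denominators leaves \<open>pi * (x - 1)\<close> below the square of
  \<open>x\<close>, which follows from pi < 4 and \<open>(x - 2)\<^sup>2 \<ge> 0\<close>.\<close>

lemma gap_estimate:
  fixes x :: real
  assumes "2 \<le> x"
  shows "(2 * pi / x)\<^sup>2 < 4 * pi / (x - 1)"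
proof -
  have "0 < (x - 2)\<^sup>2 + (4 - pi) * (x - 1)"
    using assms pi_less_4 by (intro add_nonneg_pos) auto
  then have "pi * (x - 1) < x\<^sup>2" by (simp add: power2_eq_square algebra_simps)
  then have "4 * pi * (pi * (x - 1)) < 4 * pi * x\<^sup>2" by simp
  then show ?thesis using assms by (simp add: power2_eq_square field_simps)
qed

section \<open>The spectral gap\<close>

theorem theorem1p1:
  fixes n k :: nat
  assumes "n \<ge> 4" and "1 \<le> k" and "real k \<le> real n / 2"
  shows "length (petersen_spectrum n k) = 2 * n
    \<and> petersen_spectrum n k ! 0 = 3
    \<and> petersen_spectrum n k ! 0 > petersen_spectrum n k ! 1
    \<and> petersen_spectrum n k ! 0 - petersen_spectrum n k ! 1
        < 4 * pi / (real_of_int \<lfloor>sqrt (real n)\<rfloor> - 1)"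
proof -
  have nk: "2 \<le> n" "0 < k" "k < n" using assms by auto
  define t where "t j = top_root (circ_eig n 1 j) (circ_eig n k j)" for j
  define l where "l j = low_root (circ_eig n 1 j) (circ_eig n k j)" for j
  \<comment> \<open>The spectrum with one copy of 3 removed; the entry 1 is the lower root for
    frequency 0.\<close>
  define M where "M = add_mset (1::real) (\<Sum>j\<in>{1..<n}. {#t j, l j#})"
  have "t 0 = 3" "l 0 = 1"
    by (simp_all add: t_def l_def top_root_def low_root_def circ_eig_def)
  moreover have "{..<n} = insert 0 {1..<n}" using nk by auto
  ultimately have roots: "proots (char_poly (adjacency_matrix (2 * n) (petersen_edges n k))) = add_mset 3 M"
    unfolding proots_petersen[OF nk] M_def t_def[symmetric] l_def[symmetric] by simp
  have lt: "l j < t j" for j unfolding l_def t_def by (rule top_root_bounds)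
  have t3: "t j < 3" if "j \<in> {1..<n}" for j
    unfolding t_def using that by (intro top_root_less_3 circ_eig_1_less circ_eig_le) auto
  have M3: "y < 3" if "y \<in># M" for y
    using that lt t3 by (force simp: M_def set_mset_sum intro: less_trans)
  have sizeM: "size M = 2 * n - 1"
    using nk by (simp add: M_def size_multiset_sum)
  define ys where "ys = sorted_list_of_multiset M"
  \<comment> \<open>As 3 is the maximum, it heads the descending list, and entry 1 of the spectrum
    becomes \<open>rev ys ! 0\<close>.\<close>
  have spec: "petersen_spectrum n k = 3 # rev ys"
    unfolding petersen_spectrum_def eigenvalues_desc_def roots ys_def
    using M3 by (subst sorted_list_of_multiset_add_max) (auto intro: less_imp_le)
  have ys: "sorted ys" "set ys = set_mset M" "length ys = 2 * n - 1"
    using sizeM by (auto simp: ys_def) (metis mset_sorted_list_of_multiset size_mset)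
  have "1 \<in> set ys" by (simp add: ys M_def)
  then have second: "rev ys ! 0 < 3" using M3 le_hd_rev_sorted(2)[OF ys(1)] ys(2) by blast

  define m where "m = nat \<lfloor>sqrt (real n)\<rfloor>"
  \<comment> \<open>Here \<open>n \<ge> 4\<close> gives \<open>2 \<le> m\<close>, as required by the
    frequency lemma and the final estimate.\<close>
  have "2 \<le> sqrt (real n)" using assms by (intro real_le_rsqrt) auto
  then have fl: "2 \<le> \<lfloor>sqrt (real n)\<rfloor>" by (simp add: le_floor_iff)
  then have m: "2 \<le> m" "real_of_int \<lfloor>sqrt (real n)\<rfloor> = real m" unfolding m_def by linarith+
  have "real m \<le> sqrt (real n)" using m(2) by linarith
  then have "real m * real m \<le> real n"
    by (metis mult_mono of_nat_0_le_iff real_sqrt_ge_0_iff real_sqrt_mult_self abs_of_nat)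
  then have "m * m \<le> n" by (metis of_nat_le_iff of_nat_mult)
  then obtain j where j: "0 < j" "j < n" "1 - (2 * pi / m)\<^sup>2 / 2 \<le> circ_eig n 1 j / 2"
    "1 - (2 * pi / m)\<^sup>2 / 2 \<le> circ_eig n k j / 2"
    using ex_good_frequency m(1) by metis
  \<comment> \<open>Adding the two cosine bounds gives \<open>(a + b) / 2\<close> at least
    \<open>2 - (2 * pi / m)\<^sup>2\<close>, and \<open>top_root_bounds\<close> contributes the
    remaining 1.\<close>
  have "3 - (2 * pi / m)\<^sup>2 \<le> t j"
    using j top_root_bounds(2)[of "circ_eig n 1 j" "circ_eig n k j"] unfolding t_def by argo
  moreover have "t j \<in> set ys"
    using j by (auto simp: ys M_def set_mset_sum)
  then have "t j \<le> rev ys ! 0" by (rule le_hd_rev_sorted[OF ys(1)])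
  moreover have "(2 * pi / m)\<^sup>2 < 4 * pi / (real m - 1)" using m by (intro gap_estimate) auto
  ultimately have "3 - rev ys ! 0 < 4 * pi / (real_of_int \<lfloor>sqrt (real n)\<rfloor> - 1)"
    unfolding m(2) by linarith
  then show ?thesis using spec second ys(3) nk by simp
qed

end
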